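(* Let $\mu>0$, $d>0$. Let $\psi_u,\psi_\ell:\mathbb{R}\to\mathbb{R}$ be functions for which there exists $t\in\mathbb{R}$ such that (i) $\psi_u$ is concave and non-decreasing on $\{x:x<t\}$ and on $\{x:x\ge t\}$; (ii) $\psi_\ell$ is convex and non-increasing on $\{x:x<t\}$ and on $\{x:x\ge t\}$. For $v_1<\mu<v_2$ put $$g(v_1,v_2)=\frac{w_1\psi_u(v_1)+w_2\psi_u(v_2)}{w_1\psi_\ell(v_1)+w_2\psi_\ell(v_2)},\qquad w_2=\frac{\mu-v_1}{v_2-v_1},\quad w_1=1-w_2,$$ and assume that for every fixed $v_1\in(-\infty,\mu-d/2)$ the function $g(v_1,v_2)$ is non-decreasing in $v_2$, and that for every fixed $v_2\in(\mu+d/2,\infty)$ the function $g(v_1,v_2)$ is non-increasing in $v_1$. Then the problem $$\sup_{\mathbb{P}\in\mathcal{P}(\mu,d)}\frac{\mathbb{E}_{\mathbb{P}}(\psi_u(X))}{\mathbb{E}_{\mathbb{P}}(\psi_\ell(X))}$$ reduces to (i.e. has the same optimal value as) the problem over two-point distributions $$\sup\left\{\frac{w_1\psi_u(v_1)+w_2\psi_u(v_2)}{w_1\psi_\ell(v_1)+w_2\psi_\ell(v_2)}\right\}$$ where the supremum is over all $w_1,w_2\ge 0$, $v_1<\mu-d/2$, $v_2>\mu+d/2$ with $w_1+w_2=1$, $w_1v_1+w_2v_2=\mu$ and $w_1(\mu-v_1)+w_2(v_2-\mu)=d$.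
   Context: $\mathcal{P}(\mu,d)$ is the set of all probability distributions $\mathbb{P}$ on $\mathbb{R}$ such that, for $X\sim\mathbb{P}$, $\mathbb{E}_{\mathbb{P}}(X)=\mu$ and $\mathbb{E}_{\mathbb{P}}(|X-\mu|)=d$ (mean absolute deviation $d$). The ratios appearing are understood to be well defined (finite expectations, nonzero denominators).
   Formalization: Two sign conditions are added, without which the claim fails: the denominator of g is positive (not just nonzero) for all v1 < μ < v2, and some P in P(μ,d) with ψ_u, ψ_ℓ integrable has E_P(ψ_u(X)) ≥ 0. *)

theory Defs
  imports "HOL-Probability.Probability"
begin

(* Bochner integrals of non-integrable functions are 0, so integrability of the identity
   is required explicitly (it entails integrability of the absolute deviation). *)
definition mad_distributions :: "real \<Rightarrow> real \<Rightarrow> real measure set" where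
  "mad_distributions \<mu> d =
     {P. prob_space P \<and> sets P = sets borel \<and> integrable P (\<lambda>x. x) \<and>
         (\<integral>x. x \<partial>P) = \<mu> \<and> (\<integral>x. \<bar>x - \<mu>\<bar> \<partial>P) = d}"

(* Expectation of \<psi> under the two-point distribution on {v1, v2} with mean \<mu>;
   meaningful for v1 < \<mu> < v2. *)
definition two_point_mean :: "real \<Rightarrow> (real \<Rightarrow> real) \<Rightarrow> real \<Rightarrow> real \<Rightarrow> real" where
  "two_point_mean \<mu> \<psi> v1 v2 =
     (let w2 = (\<mu> - v1) / (v2 - v1); w1 = 1 - w2 in w1 * \<psi> v1 + w2 * \<psi> v2)"

definition two_point_ratio ::
    "real \<Rightarrow> (real \<Rightarrow> real) \<Rightarrow> (real \<Rightarrow> real) \<Rightarrow> real \<Rightarrow> real \<Rightarrow> real" where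
  "two_point_ratio \<mu> \<psi>u \<psi>l v1 v2 = two_point_mean \<mu> \<psi>u v1 v2 / two_point_mean \<mu> \<psi>l v1 v2"

(* Values of the two optimization problems. Only well-defined ratios (finite expectations,
   nonzero denominator) are considered; the suprema are taken in the extended reals
   because they may be infinite. *)
definition ratio_value :: "real \<Rightarrow> real \<Rightarrow> (real \<Rightarrow> real) \<Rightarrow> (real \<Rightarrow> real) \<Rightarrow> ereal" where
  "ratio_value \<mu> d \<psi>u \<psi>l =
     Sup {ereal ((\<integral>x. \<psi>u x \<partial>P) / (\<integral>x. \<psi>l x \<partial>P)) | P.
            P \<in> mad_distributions \<mu> d \<and> integrable P \<psi>u \<and> integrable P \<psi>l \<and>
            (\<integral>x. \<psi>l x \<partial>P) \<noteq> 0}"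

definition two_point_value :: "real \<Rightarrow> real \<Rightarrow> (real \<Rightarrow> real) \<Rightarrow> (real \<Rightarrow> real) \<Rightarrow> ereal" where
  "two_point_value \<mu> d \<psi>u \<psi>l =
     Sup {ereal ((w1 * \<psi>u v1 + w2 * \<psi>u v2) / (w1 * \<psi>l v1 + w2 * \<psi>l v2)) | w1 w2 v1 v2.
            0 \<le> w1 \<and> 0 \<le> w2 \<and> v1 < \<mu> - d / 2 \<and> \<mu> + d / 2 < v2 \<and>
            w1 + w2 = 1 \<and> w1 * v1 + w2 * v2 = \<mu> \<and>
            w1 * (\<mu> - v1) + w2 * (v2 - \<mu>) = d \<and>
            w1 * \<psi>l v1 + w2 * \<psi>l v2 \<noteq> 0}"

end

theory Submission
  imports Defs
begin

text \<open>
  The reduction combines two facts, one about general distributions and one about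
  two-point distributions.

  First, every distribution is beaten by a two-point distribution whose mean absolute
  deviation is at most \<open>d\<close> (\<open>piecewise_convex_domination\<close>). The breakpoint \<open>t\<close> cuts the
  line into two cells on each of which \<open>\<psi>u\<close> is concave and \<open>\<psi>l\<close> is convex. Moving the mass
  of each cell to its barycentre keeps the mean, can only shrink the absolute deviation, and
  by Jensen's inequality raises the numerator and lowers the denominator. If all mass lies
  on one side of \<open>t\<close>, this would produce a single atom at \<open>\<mu>\<close>, to which the hypotheses on
  the two-point ratio \<open>g\<close> do not apply; the cell is then cut at \<open>\<mu>\<close>, and both halves carry
  mass because \<open>d > 0\<close>.

  Second, a two-point distribution on \<open>x1 < \<mu> < x2\<close> of deviation at most \<open>d\<close> can be spread
  out to one on \<open>v1 \<le> x1\<close> and \<open>v2 \<ge> x2\<close> of deviation exactly \<open>d\<close> (\<open>spread_to_mad\<close>), without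
  lowering \<open>g\<close> (\<open>two_point_ratio_spread\<close>). The monotonicity hypotheses do not permit moving
  the points one after the other when both \<open>x1\<close> and \<open>x2\<close> lie within \<open>d / 2\<close> of \<open>\<mu>\<close>, since each
  of them asks for the other point to be farther out. They do however compare \<open>g v1 v2\<close> with \<open>g v1 x2\<close>
  and with \<open>g x1 v2\<close>. With \<open>r = g v1 v2\<close> and \<open>h = \<psi>u - r \<psi>l\<close>, the points
  \<open>(v1, h v1)\<close>, \<open>(\<mu>, 0)\<close> and \<open>(v2, h v2)\<close> lie on a line, and the two comparisons say that \<open>h\<close>
  is not above this line at \<open>x2\<close> and at \<open>x1\<close>. Hence neither is the chord of \<open>h\<close> over \<open>[x1, x2]\<close> at \<open>\<mu>\<close>,
  which is the inequality \<open>g x1 x2 \<le> r\<close>.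

  Raising the numerator and lowering a positive denominator raises the ratio only if the
  numerator is nonnegative. A distribution with a negative numerator has a negative ratio,
  and the one with a nonnegative numerator that exists by assumption shows that the
  two-point value is nonnegative. The converse inequality holds because two-point
  distributions are themselves feasible.
\<close>

section \<open>Two-point means\<close>

lemma two_point_mean_altdef:
  assumes "a < b"
  shows "two_point_mean \<mu> f a b = ((b - \<mu>) * f a + (\<mu> - a) * f b) / (b - a)"
proof -
  have "1 - (\<mu> - a) / (b - a) = (b - \<mu>) / (b - a)"
    using assms by (simp add: field_simps)
  then show ?thesis
    by (simp add: two_point_mean_def Let_def add_divide_distrib)
qed

lemma two_point_mean_weights:
  assumes "a < b" and "w1 + w2 = 1" and "w1 * a + w2 * b = \<mu>"
  shows "two_point_mean \<mu> f a b = w1 * f a + w2 * f b"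
proof -
  have w1: "w1 = 1 - w2" using assms(2) by simp
  have "\<mu> - a = w2 * (b - a)" using assms(3) by (simp add: w1 algebra_simps)
  then have "(\<mu> - a) / (b - a) = w2" using assms(1) by simp
  then show ?thesis by (simp add: two_point_mean_def w1)
qed

text \<open>
  Clearing the positive denominator linearises a bound on the ratio: it says that the chord
  of \<open>u - r l\<close> between \<open>a\<close> and \<open>b\<close> is nonpositive at \<open>\<mu>\<close>.
\<close>

lemma two_point_ratio_le_iff:
  assumes "a < b" and "0 < two_point_mean \<mu> l a b"
  shows "two_point_ratio \<mu> u l a b \<le> r \<longleftrightarrow>
    (b - \<mu>) * (u a - r * l a) + (\<mu> - a) * (u b - r * l b) \<le> 0"
proof -
  have "two_point_ratio \<mu> u l a b \<le> r \<longleftrightarrow>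
      two_point_mean \<mu> u a b - r * two_point_mean \<mu> l a b \<le> 0"
    using assms(2) by (simp add: two_point_ratio_def pos_divide_le_eq)
  also have "two_point_mean \<mu> u a b - r * two_point_mean \<mu> l a b =
      ((b - \<mu>) * (u a - r * l a) + (\<mu> - a) * (u b - r * l b)) / (b - a)"
    unfolding two_point_mean_altdef[OF assms(1)]
    by (simp add: diff_divide_distrib[symmetric]) (simp add: algebra_simps)
  also have "\<dots> \<le> 0 \<longleftrightarrow> (b - \<mu>) * (u a - r * l a) + (\<mu> - a) * (u b - r * l b) \<le> 0"
    using assms(1) by (simp add: divide_le_0_iff)
  finally show ?thesis .
qed

text \<open>
  Two comparisons in which only one endpoint moves give the comparison in which both move,
  because each of them places \<open>u - r l\<close> at the inner point below one and the same line
  through \<open>(\<mu>, 0)\<close>.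
\<close>

lemma two_point_ratio_spread:
  assumes x: "x1 < \<mu>" "\<mu> < x2" and v: "v1 < \<mu>" "\<mu> < v2"
    and pos: "\<And>a b. a < \<mu> \<Longrightarrow> \<mu> < b \<Longrightarrow> 0 < two_point_mean \<mu> l a b"
    and right: "two_point_ratio \<mu> u l v1 x2 \<le> two_point_ratio \<mu> u l v1 v2"
    and left: "two_point_ratio \<mu> u l x1 v2 \<le> two_point_ratio \<mu> u l v1 v2"
  shows "two_point_ratio \<mu> u l x1 x2 \<le> two_point_ratio \<mu> u l v1 v2"
proof -
  define r where "r = two_point_ratio \<mu> u l v1 v2"
  define h where "h = (\<lambda>x. u x - r * l x)"
  define c where "c = h v2 / (v2 - \<mu>)"
  \<comment> \<open>The line through the graph of \<open>h\<close> at \<open>v1\<close> and \<open>v2\<close> is \<open>x \<mapsto> c (x - \<mu>)\<close>.\<close>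
  have hv2: "h v2 = c * (v2 - \<mu>)" using v by (simp add: c_def)
  have "(v2 - \<mu>) * h v1 + (\<mu> - v1) * h v2 = 0"
  proof -
    have D: "0 < two_point_mean \<mu> l v1 v2" using pos v by blast
    have "two_point_mean \<mu> u v1 v2 = r * two_point_mean \<mu> l v1 v2"
      using D by (simp add: r_def two_point_ratio_def)
    then show ?thesis using v
      by (simp add: two_point_mean_altdef h_def field_simps)
  qed
  then have "(v2 - \<mu>) * (h v1 + c * (\<mu> - v1)) = 0"
    by (simp add: hv2 algebra_simps)
  then have hv1: "h v1 = - c * (\<mu> - v1)" using v by simp
  have "(x2 - \<mu>) * h v1 + (\<mu> - v1) * h x2 \<le> 0"
    using two_point_ratio_le_iff[of v1 x2 \<mu> l u r] right x v pos unfolding h_def r_def by force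
  then have "(\<mu> - v1) * (h x2 - c * (x2 - \<mu>)) \<le> 0"
    by (simp add: hv1 algebra_simps)
  then have hx2: "h x2 - c * (x2 - \<mu>) \<le> 0" using v by (simp add: mult_le_0_iff)
  have "(v2 - \<mu>) * h x1 + (\<mu> - x1) * h v2 \<le> 0"
    using two_point_ratio_le_iff[of x1 v2 \<mu> l u r] left x v pos unfolding h_def r_def by force
  then have "(v2 - \<mu>) * (h x1 + c * (\<mu> - x1)) \<le> 0"
    by (simp add: hv2 algebra_simps)
  then have hx1: "h x1 + c * (\<mu> - x1) \<le> 0" using v by (simp add: mult_le_0_iff)
  have "(x2 - \<mu>) * h x1 + (\<mu> - x1) * h x2 =
      (x2 - \<mu>) * (h x1 + c * (\<mu> - x1)) + (\<mu> - x1) * (h x2 - c * (x2 - \<mu>))"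
    by (simp add: algebra_simps)
  also have "\<dots> \<le> 0"
    using hx1 hx2 x by (intro add_nonpos_nonpos; intro mult_nonneg_nonpos) auto
  finally show ?thesis
    using two_point_ratio_le_iff[of x1 x2 \<mu> l u r] x pos unfolding h_def r_def by force
qed

text \<open>
  With \<open>a = \<mu> - x1\<close> and \<open>b = x2 - \<mu>\<close> the deviation of the two-point distribution is
  \<open>2 / (1/a + 1/b)\<close>. It scales with \<open>(a, b)\<close>, so a dilation around \<open>\<mu>\<close> brings it to \<open>d\<close>.
  Both arms then exceed \<open>d / 2\<close>, as their reciprocals are positive and add up to \<open>2 / d\<close>.
\<close>

lemma spread_to_mad:
  fixes \<mu> d :: real
  assumes "d > 0" "x1 < \<mu>" "\<mu> < x2" and le: "2 * (\<mu> - x1) * (x2 - \<mu>) \<le> d * (x2 - x1)"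
  obtains v1 v2 where "v1 \<le> x1" "x2 \<le> v2" "v1 < \<mu> - d / 2" "\<mu> + d / 2 < v2"
    "2 * (\<mu> - v1) * (v2 - \<mu>) = d * (v2 - v1)"
proof -
  define a b where "a = \<mu> - x1" and "b = x2 - \<mu>"
  have ab: "a > 0" "b > 0" "2 * a * b \<le> d * (a + b)"
    using assms by (auto simp: a_def b_def)
  define k where "k = d * (a + b) / (2 * a * b)"
  have k: "1 \<le> k" using ab by (simp add: k_def field_simps)
  have ka: "k * a = d / 2 + d * a / (2 * b)" and kb: "k * b = d / 2 + d * b / (2 * a)"
    using ab by (simp_all add: k_def field_simps)
  have kab: "2 * (k * a) * (k * b) = d * (k * a + k * b)"
  proof -
    have "2 * a * b * k = d * (a + b)" using ab by (simp add: k_def)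
    then have "k * (2 * a * b * k) = k * (d * (a + b))" by simp
    then show ?thesis by (simp add: algebra_simps)
  qed
  have grow: "a \<le> k * a" "b \<le> k * b" using k ab by simp_all
  have x: "x1 = \<mu> - a" "x2 = \<mu> + b" by (simp_all add: a_def b_def)
  show thesis
  proof (rule that[of "\<mu> - k * a" "\<mu> + k * b"])
    show "\<mu> - k * a \<le> x1" using grow by (simp add: x)
    show "x2 \<le> \<mu> + k * b" using grow by (simp add: x)
    show "\<mu> - k * a < \<mu> - d / 2" using ab assms(1) by (simp add: ka)
    show "\<mu> + d / 2 < \<mu> + k * b" using ab assms(1) by (simp add: kb)
    show "2 * (\<mu> - (\<mu> - k * a)) * (\<mu> + k * b - \<mu>) = d * (\<mu> + k * b - (\<mu> - k * a))"
      using kab by (simp add: algebra_simps)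
  qed
qed

section \<open>Jensen's inequality on a cell\<close>

text \<open>
  Jensen's inequality for the part of a distribution that lies in an arbitrary interval. A
  cell may contain an endpoint, where a convex function can jump and have no supporting
  line; but a barycentre at an endpoint means that all mass of the cell sits there, and the
  inequality becomes an equality.
\<close>

lemma jensen_on_cell:
  fixes f :: "real \<Rightarrow> real"
  assumes P: "prob_space P" "sets P = sets borel" and X: "integrable P (\<lambda>x. x)"
    and S: "S \<in> sets borel" "convex S" and pos: "0 < measure P S"
  defines "m \<equiv> (LINT x:S|P. x) / measure P S"
  shows "m \<in> S"
    and "integrable P f \<Longrightarrow> convex_on S f \<Longrightarrow> measure P S * f m \<le> (LINT x:S|P. f x)"
proof -
  interpret prob_space P by fact
  have SP: "S \<in> sets P" using P S by simp
  have int: "set_integrable P S g" if "integrable P g" for g :: "real \<Rightarrow> real"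
    unfolding set_integrable_def using integrable_mult_indicator[OF SP that] .
  have lin: "(LINT x:S|P. a + c * (x - m)) = a * measure P S" for a c
  proof -
    have "(LINT x:S|P. a + c * (x - m)) = (LINT x:S|P. (a - c * m) + c * x)"
      by (simp add: algebra_simps)
    also have "\<dots> = (LINT x:S|P. a - c * m) + (LINT x:S|P. c * x)"
      using int X by (intro set_integral_add) auto
    also have "\<dots> = (a - c * m) * measure P S + c * (LINT x:S|P. x)"
      using SP by (simp add: set_lebesgue_integral_def)
    also have "\<dots> = a * measure P S" using pos by (simp add: m_def algebra_simps)
    finally show ?thesis .
  qed
  \<comment> \<open>A barycentre with no mass on one side forces the whole mass of the cell onto itself.\<close>
  have concentrated: "AE x\<in>S in P. x = m" if \<sigma>: "\<sigma> \<noteq> 0" "\<And>x. x \<in> S \<Longrightarrow> 0 \<le> \<sigma> * (x - m)" for \<sigma> :: real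
  proof -
    have "(LINT x|P. indicator S x * (\<sigma> * (x - m))) = 0"
      using lin[of 0 \<sigma>] unfolding set_lebesgue_integral_def add_0 real_scaleR_def by simp
    moreover have "integrable P (\<lambda>x. indicator S x * (\<sigma> * (x - m)))"
      using int[of "\<lambda>x. \<sigma> * (x - m)"] X by (simp add: set_integrable_def)
    moreover have "AE x in P. 0 \<le> indicator S x * (\<sigma> * (x - m))"
      using \<sigma> by (auto simp: indicator_def)
    ultimately have "AE x in P. indicator S x * (\<sigma> * (x - m)) = 0"
      using integral_nonneg_eq_0_iff_AE by blast
    then show ?thesis by eventually_elim (use \<sigma>(1) in \<open>auto split: split_indicator_asm\<close>)
  qed
  have mem: "m \<in> S" if AE: "AE x\<in>S in P. x = m"
  proof (rule ccontr)
    assume "m \<notin> S"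
    with AE have "AE x in P. x \<notin> S" by auto
    then have "measure P S = 0"
      using SP by (subst (asm) AE_iff_measurable[of S]) (auto simp: measure_def dest: sets.sets_into_space)
    with pos show False by simp
  qed
  have split: "(AE x\<in>S in P. x = m) \<or> m \<in> interior S"
  proof (cases "(\<forall>x\<in>S. m \<le> x) \<or> (\<forall>x\<in>S. x \<le> m)")
    case True
    then show ?thesis using concentrated[of 1] concentrated[of "-1"] by auto
  next
    case False
    then obtain a b where ab: "a \<in> S" "a < m" "b \<in> S" "m < b" by force
    have "{a..b} \<subseteq> S"
      using mem_is_interval_1_I[OF _ ab(1,3)] S(2) by (auto simp: is_interval_convex_1)
    then have "{a<..<b} \<subseteq> interior S"
      by (intro interior_maximal) (auto simp: subset_eq)
    then show ?thesis using ab by auto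
  qed
  then show mS: "m \<in> S" using mem interior_subset by blast
  assume f: "integrable P f" "convex_on S f"
  from split show "measure P S * f m \<le> (LINT x:S|P. f x)"
  proof
    assume "m \<in> interior S"
    define c where "c = Inf ((\<lambda>t. (f m - f t) / (m - t)) ` ({m<..} \<inter> S))"
    have "f m + c * (y - m) \<le> f y" if "y \<in> S" for y
      using convex_le_Inf_differential[OF f(2) \<open>m \<in> interior S\<close> that] by (simp add: c_def)
    then have "(LINT x:S|P. f m + c * (x - m)) \<le> (LINT x:S|P. f x)"
      using int f(1) X by (intro set_integral_mono) auto
    then show ?thesis by (simp add: lin mult.commute)
  next
    assume AE: "AE x\<in>S in P. x = m"
    have "(LINT x:S|P. f x) = (LINT x:S|P. f m)"
    proof (rule set_lebesgue_integral_cong_AE)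
      show "f \<in> borel_measurable P" using f(1) by auto
      show "AE x\<in>S in P. f x = f m" using AE by eventually_elim auto
    qed (use SP in auto)
    then show ?thesis using SP by (simp add: set_lebesgue_integral_def)
  qed
qed

section \<open>Domination by a two-point distribution\<close>

text \<open>
  The two points are the barycentres of the cells. They do not depend on \<open>f\<close>, so the same
  two-point distribution serves the numerator and the denominator. The ordering of the
  cells separates the barycentres strictly, hence \<open>\<mu>\<close> lies strictly between them.
\<close>

lemma two_cell_domination:
  assumes P: "P \<in> mad_distributions \<mu> d"
    and A: "A \<in> sets borel" "convex A" "0 < measure P A"
    and B: "B \<in> sets borel" "convex B" "0 < measure P B"
    and less: "\<And>a b. a \<in> A \<Longrightarrow> b \<in> B \<Longrightarrow> a < b"
    and cover: "AE x in P. x \<in> A \<union> B"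
  obtains x1 x2 where "x1 < \<mu>" "\<mu> < x2" "2 * (\<mu> - x1) * (x2 - \<mu>) \<le> d * (x2 - x1)"
    "\<And>f. integrable P f \<Longrightarrow> convex_on A f \<Longrightarrow> convex_on B f \<Longrightarrow>
        two_point_mean \<mu> f x1 x2 \<le> (\<integral>x. f x \<partial>P)"
proof -
  have prob: "prob_space P" and sets: "sets P = sets borel" and X: "integrable P (\<lambda>x. x)"
    and mean: "(\<integral>x. x \<partial>P) = \<mu>" and mad: "(\<integral>x. \<bar>x - \<mu>\<bar> \<partial>P) = d"
    using P by (auto simp: mad_distributions_def)
  interpret prob_space P by fact
  have AP: "A \<in> sets P" and BP: "B \<in> sets P" using A B sets by auto
  have disj: "A \<inter> B = {}" using less by force
  define p q where "p = measure P A" and "q = measure P B"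
  define x1 x2 where "x1 = (LINT x:A|P. x) / p" and "x2 = (LINT x:B|P. x) / q"
  have pq: "0 < p" "0 < q" using A B by (auto simp: p_def q_def)
  have int: "set_integrable P A g" "set_integrable P B g" if "integrable P g" for g :: "real \<Rightarrow> real"
    unfolding set_integrable_def
    using integrable_mult_indicator[OF AP that] integrable_mult_indicator[OF BP that] by auto
  have total: "(\<integral>x. g x \<partial>P) = (LINT x:A|P. g x) + (LINT x:B|P. g x)" if g: "integrable P g"
    for g :: "real \<Rightarrow> real"
  proof -
    have "(LINT x:A|P. g x) + (LINT x:B|P. g x) = (LINT x:A \<union> B|P. g x)"
      using set_integral_Un[OF disj int[OF g]] by simp
    also have "\<dots> = (\<integral>x. g x \<partial>P)"
      unfolding set_lebesgue_integral_def using cover g AP BP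
      by (intro integral_cong_AE) (auto split: split_indicator)
    finally show ?thesis by simp
  qed
  have pq1: "p + q = 1"
    using total[of "\<lambda>_. 1"] AP BP prob_space by (simp add: p_def q_def set_lebesgue_integral_def)
  have mean': "p * x1 + q * x2 = \<mu>"
    using total[OF X] pq mean by (simp add: x1_def x2_def)
  have "x1 \<in> A" "x2 \<in> B"
    using jensen_on_cell(1)[OF prob sets X A] jensen_on_cell(1)[OF prob sets X B]
    by (auto simp: x1_def x2_def p_def q_def)
  then have lt: "x1 < x2" by (rule less)
  have p: "p = 1 - q" using pq1 by simp
  have e1: "\<mu> - x1 = q * (x2 - x1)" and e2: "x2 - \<mu> = p * (x2 - x1)"
    using mean' by (simp_all add: p algebra_simps)
  have "0 < q * (x2 - x1)" "0 < p * (x2 - x1)" using lt pq by simp_all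
  then have x1\<mu>: "x1 < \<mu>" and \<mu>x2: "\<mu> < x2" using e1 e2 by linarith+
  \<comment> \<open>Concentrating each cell can only reduce the absolute deviation, which
      is \<open>2 p q (x2 - x1)\<close> for the resulting two-point distribution.\<close>
  have "(LINT x:A|P. \<mu> - x) = p * (\<mu> - x1)" "(LINT x:B|P. x - \<mu>) = q * (x2 - \<mu>)"
    using AP BP pq by (simp_all add: set_integral_diff(2)[OF int(1) int(1)] set_integral_diff(2)[OF int(2) int(2)] X
        set_integral_const x1_def x2_def p_def q_def right_diff_distrib)
  moreover have "(LINT x:A|P. \<mu> - x) \<le> (LINT x:A|P. \<bar>x - \<mu>\<bar>)"
    "(LINT x:B|P. x - \<mu>) \<le> (LINT x:B|P. \<bar>x - \<mu>\<bar>)"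
    by (intro set_integral_mono int Bochner_Integration.integrable_diff integrable_abs X; simp)+
  ultimately have "p * (\<mu> - x1) + q * (x2 - \<mu>) \<le> d"
    using total[of "\<lambda>x. \<bar>x - \<mu>\<bar>"] X mad by simp
  then have "2 * p * q * (x2 - x1) \<le> d" by (simp add: e1 e2 algebra_simps)
  then have "2 * p * q * (x2 - x1) * (x2 - x1) \<le> d * (x2 - x1)"
    using lt by (intro mult_right_mono) auto
  then have "2 * (\<mu> - x1) * (x2 - \<mu>) \<le> d * (x2 - x1)" by (simp add: e1 e2 mult_ac)
  moreover have "two_point_mean \<mu> f x1 x2 \<le> (\<integral>x. f x \<partial>P)"
    if f: "integrable P f" "convex_on A f" "convex_on B f" for f
  proof -
    have "two_point_mean \<mu> f x1 x2 = p * f x1 + q * f x2"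
      using two_point_mean_weights lt pq1 mean' by blast
    also have "\<dots> \<le> (LINT x:A|P. f x) + (LINT x:B|P. f x)"
      using jensen_on_cell(2)[OF prob sets X A f(1,2)] jensen_on_cell(2)[OF prob sets X B f(1,3)]
      by (simp add: x1_def x2_def p_def q_def add_mono)
    finally show ?thesis using total[OF f(1)] by simp
  qed
  ultimately show thesis using that x1\<mu> \<mu>x2 by blast
qed

text \<open>
  If one side of \<open>\<mu>\<close> were null, \<open>\<bar>x - \<mu>\<bar>\<close> would agree almost everywhere with \<open>x - \<mu>\<close> or its
  negative, whose mean is zero.
\<close>

lemma mad_both_sides:
  assumes P: "P \<in> mad_distributions \<mu> d" and "d > 0"
  shows "0 < measure P {..<\<mu>}" and "0 < measure P {\<mu>..}"
proof -
  have prob: "prob_space P" and sets: "sets P = sets borel" and X: "integrable P (\<lambda>x. x)"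
    and mean: "(\<integral>x. x \<partial>P) = \<mu>" and mad: "(\<integral>x. \<bar>x - \<mu>\<bar> \<partial>P) = d"
    using P by (auto simp: mad_distributions_def)
  interpret prob_space P by fact
  have *: False if AE: "AE x in P. \<bar>x - \<mu>\<bar> = \<sigma> * (x - \<mu>)" for \<sigma>
  proof -
    have [measurable]: "(\<lambda>x. x) \<in> borel_measurable P"
      using X by (rule borel_measurable_integrable)
    have "(\<integral>x. \<bar>x - \<mu>\<bar> \<partial>P) = (\<integral>x. \<sigma> * (x - \<mu>) \<partial>P)"
      by (rule integral_cong_AE[OF _ _ AE]) measurable
    also have "\<dots> = 0" using X mean prob_space by simp
    finally show False using mad \<open>d > 0\<close> by simp
  qed
  have "\<not> measure P {..<\<mu>} = 0"
  proof
    assume "measure P {..<\<mu>} = 0"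
    then have "AE x in P. x \<notin> {..<\<mu>}"
      using sets by (intro AE_not_in null_setsI) (auto simp: emeasure_eq_measure)
    then have "AE x in P. \<bar>x - \<mu>\<bar> = 1 * (x - \<mu>)" by eventually_elim auto
    then show False by (rule *)
  qed
  then show "0 < measure P {..<\<mu>}" by (simp add: zero_less_measure_iff)
  have "\<not> measure P {\<mu>..} = 0"
  proof
    assume "measure P {\<mu>..} = 0"
    then have "AE x in P. x \<notin> {\<mu>..}"
      using sets by (intro AE_not_in null_setsI) (auto simp: emeasure_eq_measure)
    then have "AE x in P. \<bar>x - \<mu>\<bar> = - 1 * (x - \<mu>)" by eventually_elim auto
    then show False by (rule *)
  qed
  then show "0 < measure P {\<mu>..}" by (simp add: zero_less_measure_iff)
qed

text \<open>
  The cells are the two sides of \<open>t\<close> or, if one of these is null, the two sides of \<open>\<mu>\<close> within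
  the other.
\<close>

lemma piecewise_convex_domination:
  assumes P: "P \<in> mad_distributions \<mu> d" and "d > 0"
  obtains x1 x2 where "x1 < \<mu>" "\<mu> < x2" "2 * (\<mu> - x1) * (x2 - \<mu>) \<le> d * (x2 - x1)"
    "\<And>f. integrable P f \<Longrightarrow> convex_on {..<t} f \<Longrightarrow> convex_on {t..} f \<Longrightarrow>
        two_point_mean \<mu> f x1 x2 \<le> (\<integral>x. f x \<partial>P)"
proof -
  have prob: "prob_space P" and sets: "sets P = sets borel"
    using P by (auto simp: mad_distributions_def)
  interpret prob_space P by fact
  note witness = that
  have one_piece: thesis if S: "S = {..<t} \<or> S = {t..}" and AE: "AE x in P. x \<in> S" for S
  proof -
    have Sb: "S \<in> sets borel" "convex S" using S by auto
    have "measure P (S \<inter> T) = measure P T" if "T \<in> sets borel" for T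
    proof (rule measure_eq_AE)
      show "AE x in P. x \<in> S \<inter> T \<longleftrightarrow> x \<in> T" using AE by eventually_elim auto
    qed (use that Sb sets in auto)
    then have *: "0 < measure P (S \<inter> {..<\<mu>})" "0 < measure P (S \<inter> {\<mu>..})"
      using mad_both_sides[OF assms] by simp_all
    have c: "convex (S \<inter> {..<\<mu>})" "convex (S \<inter> {\<mu>..})"
      using Sb by (auto intro: convex_Int)
    show thesis
    proof (rule two_cell_domination[OF P _ c(1) *(1) _ c(2) *(2)])
      show "AE x in P. x \<in> S \<inter> {..<\<mu>} \<union> S \<inter> {\<mu>..}" using AE by eventually_elim auto
    next
      fix x1 x2
      assume x: "x1 < \<mu>" "\<mu> < x2" "2 * (\<mu> - x1) * (x2 - \<mu>) \<le> d * (x2 - x1)"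
        and f: "\<And>f. integrable P f \<Longrightarrow> convex_on (S \<inter> {..<\<mu>}) f \<Longrightarrow> convex_on (S \<inter> {\<mu>..}) f \<Longrightarrow>
            two_point_mean \<mu> f x1 x2 \<le> (\<integral>x. f x \<partial>P)"
      show thesis
      proof (rule witness[OF x])
        fix f
        assume *: "integrable P f" "convex_on {..<t} f" "convex_on {t..} f"
        have "convex_on S f" using * S by auto
        then show "two_point_mean \<mu> f x1 x2 \<le> (\<integral>x. f x \<partial>P)"
          using f[OF *(1)] c by (meson convex_on_subset inf_le1)
      qed
    qed (use Sb in auto)
  qed
  show thesis
  proof (cases "measure P {..<t} = 0 \<or> measure P {t..} = 0")
    case True
    then show thesis
    proof
      assume "measure P {..<t} = 0"
      then have "AE x in P. x \<notin> {..<t}"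
        using sets by (intro AE_not_in null_setsI) (auto simp: emeasure_eq_measure)
      then have "AE x in P. x \<in> {t..}" by eventually_elim auto
      then show thesis by (rule one_piece[of "{t..}", OF disjI2[OF refl]])
    next
      assume "measure P {t..} = 0"
      then have "AE x in P. x \<notin> {t..}"
        using sets by (intro AE_not_in null_setsI) (auto simp: emeasure_eq_measure)
      then have "AE x in P. x \<in> {..<t}" by eventually_elim auto
      then show thesis by (rule one_piece[of "{..<t}", OF disjI1[OF refl]])
    qed
  next
    case False
    then have pos: "0 < measure P {..<t}" "0 < measure P {t..}"
      by (auto simp: zero_less_measure_iff)
    show thesis
    proof (rule two_cell_domination[OF P _ _ pos(1) _ _ pos(2)])
      show "AE x in P. x \<in> {..<t} \<union> {t..}" by auto
    qed (use witness in auto)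
  qed
qed

section \<open>Two-point distributions as measures\<close>

lemma two_point_distribution:
  fixes w1 w2 v1 v2 \<mu> d :: real
  assumes w: "0 \<le> w1" "0 \<le> w2" "w1 + w2 = 1" and v: "v1 \<le> \<mu>" "\<mu> \<le> v2"
    and mean: "w1 * v1 + w2 * v2 = \<mu>" and mad: "w1 * (\<mu> - v1) + w2 * (v2 - \<mu>) = d"
  obtains P where "P \<in> mad_distributions \<mu> d"
    "\<And>f :: real \<Rightarrow> real. f \<in> borel_measurable borel \<Longrightarrow> integrable P f"
    "\<And>f. f \<in> borel_measurable borel \<Longrightarrow> (\<integral>x. f x \<partial>P) = w1 * f v1 + w2 * f v2"
proof -
  define P where
    "P = distr (measure_pmf (bernoulli_pmf w1)) borel (\<lambda>b. if b then v1 else v2)"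
  have w2: "w2 = 1 - w1" and w1: "w1 \<le> 1" using w by auto
  have int: "integrable P f" if f: "f \<in> borel_measurable borel" for f :: "real \<Rightarrow> real"
    unfolding P_def using f
    by (subst integrable_distr_eq) (auto intro!: integrable_measure_pmf_finite)
  have val: "(\<integral>x. f x \<partial>P) = w1 * f v1 + w2 * f v2" if f: "f \<in> borel_measurable borel"
    for f :: "real \<Rightarrow> real"
    unfolding P_def using f w w1 by (subst integral_distr) (auto simp: w2 mult.commute)
  have "P \<in> mad_distributions \<mu> d"
    unfolding mad_distributions_def
  proof (intro CollectI conjI)
    show "prob_space P"
      unfolding P_def by (intro prob_space.prob_space_distr prob_space_measure_pmf) auto
    show "(\<integral>x. \<bar>x - \<mu>\<bar> \<partial>P) = d" using v mad by (subst val) auto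
    show "integrable P (\<lambda>x. x)" "(\<integral>x. x \<partial>P) = \<mu>"
      using mean by (simp_all add: val int)
  qed (simp add: P_def)
  from that[OF this int val] show thesis .
qed

lemma borel_measurable_two_piece_mono:
  fixes f :: "real \<Rightarrow> real"
  assumes "mono_on {..<t} f" "mono_on {t..} f"
  shows "f \<in> borel_measurable borel"
  using assms by (intro borel_measurable_piecewise_mono[of "{{..<t}, {t..}}"]) auto

section \<open>Reduction to two-point distributions\<close>

theorem theorem2p2:
  fixes \<mu> d :: real and \<psi>u \<psi>l :: "real \<Rightarrow> real"
  assumes "\<mu> > 0" and "d > 0"
    and "\<exists>t. concave_on {..<t} \<psi>u \<and> mono_on {..<t} \<psi>u \<and>
             concave_on {t..} \<psi>u \<and> mono_on {t..} \<psi>u \<and>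
             convex_on {..<t} \<psi>l \<and> antimono_on {..<t} \<psi>l \<and>
             convex_on {t..} \<psi>l \<and> antimono_on {t..} \<psi>l"
    and denominator_pos: "\<And>v1 v2. v1 < \<mu> \<Longrightarrow> \<mu> < v2 \<Longrightarrow> 0 < two_point_mean \<mu> \<psi>l v1 v2"
    and numerator_nonneg: "\<exists>P \<in> mad_distributions \<mu> d.
          integrable P \<psi>u \<and> integrable P \<psi>l \<and> 0 \<le> (\<integral>x. \<psi>u x \<partial>P)"
    and "\<And>v1. v1 < \<mu> - d / 2 \<Longrightarrow>
          mono_on {\<mu><..} (\<lambda>v2. two_point_ratio \<mu> \<psi>u \<psi>l v1 v2)"
    and "\<And>v2. \<mu> + d / 2 < v2 \<Longrightarrow>
          antimono_on {..<\<mu>} (\<lambda>v1. two_point_ratio \<mu> \<psi>u \<psi>l v1 v2)"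
  shows "ratio_value \<mu> d \<psi>u \<psi>l = two_point_value \<mu> d \<psi>u \<psi>l"
proof (rule antisym)
  obtain t where u: "concave_on {..<t} \<psi>u" "mono_on {..<t} \<psi>u" "concave_on {t..} \<psi>u" "mono_on {t..} \<psi>u"
    and l: "convex_on {..<t} \<psi>l" "antimono_on {..<t} \<psi>l" "convex_on {t..} \<psi>l" "antimono_on {t..} \<psi>l"
    using assms(3) by blast
  have u_meas: "\<psi>u \<in> borel_measurable borel"
    using u borel_measurable_two_piece_mono by blast
  have "(\<lambda>x. - \<psi>l x) \<in> borel_measurable borel"
    using l by (intro borel_measurable_two_piece_mono[of t]) (auto simp: monotone_on_def)
  then have l_meas: "\<psi>l \<in> borel_measurable borel" by simp

  \<comment> \<open>Two-point distributions of deviation at most \<open>d\<close> do not beat those of deviation \<open>d\<close>.\<close>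
  have below: "ereal (two_point_ratio \<mu> \<psi>u \<psi>l x1 x2) \<le> two_point_value \<mu> d \<psi>u \<psi>l"
    if x: "x1 < \<mu>" "\<mu> < x2" and le: "2 * (\<mu> - x1) * (x2 - \<mu>) \<le> d * (x2 - x1)" for x1 x2
  proof -
    obtain v1 v2 where v: "v1 \<le> x1" "x2 \<le> v2" "v1 < \<mu> - d / 2" "\<mu> + d / 2 < v2"
      "2 * (\<mu> - v1) * (v2 - \<mu>) = d * (v2 - v1)"
      using spread_to_mad[OF \<open>d > 0\<close> x le] by blast
    have v\<mu>: "v1 < \<mu>" "\<mu> < v2" using v \<open>d > 0\<close> by auto
    have "two_point_ratio \<mu> \<psi>u \<psi>l x1 x2 \<le> two_point_ratio \<mu> \<psi>u \<psi>l v1 v2"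
    proof (rule two_point_ratio_spread[OF x v\<mu> denominator_pos])
      show "two_point_ratio \<mu> \<psi>u \<psi>l v1 x2 \<le> two_point_ratio \<mu> \<psi>u \<psi>l v1 v2"
        using assms(6)[OF v(3)] x v v\<mu> by (auto simp: monotone_on_def)
      show "two_point_ratio \<mu> \<psi>u \<psi>l x1 v2 \<le> two_point_ratio \<mu> \<psi>u \<psi>l v1 v2"
        using assms(7)[OF v(4)] x v v\<mu> by (auto simp: monotone_on_def)
    qed
    moreover have "ereal (two_point_ratio \<mu> \<psi>u \<psi>l v1 v2) \<le> two_point_value \<mu> d \<psi>u \<psi>l"
    proof -
      define w1 w2 where "w1 = (v2 - \<mu>) / (v2 - v1)" and "w2 = (\<mu> - v1) / (v2 - v1)"
      have w: "0 \<le> w1" "0 \<le> w2" "w1 + w2 = 1" using v\<mu>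
        by (auto simp: w1_def w2_def add_divide_distrib[symmetric])
      have "(v2 - v1) * w1 = v2 - \<mu>" "(v2 - v1) * w2 = \<mu> - v1"
        using v\<mu> by (simp_all add: w1_def w2_def)
      then have "((v2 - v1) * w1) * v1 + ((v2 - v1) * w2) * v2 = (v2 - v1) * \<mu>"
        by (simp only:) (simp add: algebra_simps)
      then have "(v2 - v1) * (w1 * v1 + w2 * v2) = (v2 - v1) * \<mu>"
        by (simp add: distrib_left mult.assoc)
      then have mean: "w1 * v1 + w2 * v2 = \<mu>" using v\<mu> by simp
      have "w1 * (\<mu> - v1) + w2 * (v2 - \<mu>) = (2 * (\<mu> - v1) * (v2 - \<mu>)) / (v2 - v1)"
        by (simp add: w1_def w2_def add_divide_distrib[symmetric] mult.commute)
      also have "\<dots> = d" unfolding v(5) using v\<mu> by simp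
      finally have mad: "w1 * (\<mu> - v1) + w2 * (v2 - \<mu>) = d" .
      have tp: "two_point_mean \<mu> f v1 v2 = w1 * f v1 + w2 * f v2" for f
        using two_point_mean_weights[OF _ w(3) mean] v\<mu> by simp
      have nz: "w1 * \<psi>l v1 + w2 * \<psi>l v2 \<noteq> 0"
        using denominator_pos[OF v\<mu>] by (simp add: tp)
      show ?thesis
        unfolding two_point_value_def two_point_ratio_def tp
        by (rule Sup_upper, rule CollectI, rule exI[of _ w1], rule exI[of _ w2],
            rule exI[of _ v1], rule exI[of _ v2]) (intro conjI refl w v mean mad nz)
    qed
    ultimately show ?thesis by (meson ereal_less_eq(3) order_trans)
  qed

  have nonneg: "0 \<le> (\<integral>x. \<psi>u x \<partial>P) / (\<integral>x. \<psi>l x \<partial>P) \<longleftrightarrow> 0 \<le> (\<integral>x. \<psi>u x \<partial>P)"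
    and bound: "0 \<le> (\<integral>x. \<psi>u x \<partial>P) \<Longrightarrow>
      ereal ((\<integral>x. \<psi>u x \<partial>P) / (\<integral>x. \<psi>l x \<partial>P)) \<le> two_point_value \<mu> d \<psi>u \<psi>l"
    if P: "P \<in> mad_distributions \<mu> d" and iu: "integrable P \<psi>u" and il: "integrable P \<psi>l" for P
  proof -
    obtain x1 x2 where x: "x1 < \<mu>" "\<mu> < x2" "2 * (\<mu> - x1) * (x2 - \<mu>) \<le> d * (x2 - x1)"
      and dom: "\<And>f. integrable P f \<Longrightarrow> convex_on {..<t} f \<Longrightarrow> convex_on {t..} f \<Longrightarrow>
        two_point_mean \<mu> f x1 x2 \<le> (\<integral>x. f x \<partial>P)"
      using piecewise_convex_domination[OF P \<open>d > 0\<close>] by metis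
    have L: "two_point_mean \<mu> \<psi>l x1 x2 \<le> (\<integral>x. \<psi>l x \<partial>P)" using dom il l by blast
    have "two_point_mean \<mu> (\<lambda>x. - \<psi>u x) x1 x2 \<le> (\<integral>x. - \<psi>u x \<partial>P)"
      using iu u by (intro dom) (auto simp: concave_on_def)
    then have U: "(\<integral>x. \<psi>u x \<partial>P) \<le> two_point_mean \<mu> \<psi>u x1 x2"
      by (simp add: two_point_mean_def Let_def)
    have D: "0 < two_point_mean \<mu> \<psi>l x1 x2" using denominator_pos x by blast
    then show "0 \<le> (\<integral>x. \<psi>u x \<partial>P) / (\<integral>x. \<psi>l x \<partial>P) \<longleftrightarrow> 0 \<le> (\<integral>x. \<psi>u x \<partial>P)"
      using L by (simp add: zero_le_divide_iff)
    assume "0 \<le> (\<integral>x. \<psi>u x \<partial>P)"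
    then have "(\<integral>x. \<psi>u x \<partial>P) / (\<integral>x. \<psi>l x \<partial>P) \<le> two_point_ratio \<mu> \<psi>u \<psi>l x1 x2"
      unfolding two_point_ratio_def using L U D by (intro frac_le) auto
    then show "ereal ((\<integral>x. \<psi>u x \<partial>P) / (\<integral>x. \<psi>l x \<partial>P)) \<le> two_point_value \<mu> d \<psi>u \<psi>l"
      using below[OF x] by (meson ereal_less_eq(3) order_trans)
  qed

  obtain P0 where P0: "P0 \<in> mad_distributions \<mu> d" "integrable P0 \<psi>u" "integrable P0 \<psi>l"
    "0 \<le> (\<integral>x. \<psi>u x \<partial>P0)"
    using numerator_nonneg by blast
  have "0 \<le> ereal ((\<integral>x. \<psi>u x \<partial>P0) / (\<integral>x. \<psi>l x \<partial>P0))"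
    using nonneg[OF P0(1-3)] P0(4) by simp
  then have value_nonneg: "0 \<le> two_point_value \<mu> d \<psi>u \<psi>l"
    using bound[OF P0] by (rule order_trans)

  show "ratio_value \<mu> d \<psi>u \<psi>l \<le> two_point_value \<mu> d \<psi>u \<psi>l"
    unfolding ratio_value_def
  proof (rule Sup_least, clarify)
    fix P
    assume P: "P \<in> mad_distributions \<mu> d" "integrable P \<psi>u" "integrable P \<psi>l"
    show "ereal ((\<integral>x. \<psi>u x \<partial>P) / (\<integral>x. \<psi>l x \<partial>P)) \<le> two_point_value \<mu> d \<psi>u \<psi>l"
    proof (cases "0 \<le> (\<integral>x. \<psi>u x \<partial>P)")
      case True
      then show ?thesis using bound P by blast
    next
      case False
      then have "ereal ((\<integral>x. \<psi>u x \<partial>P) / (\<integral>x. \<psi>l x \<partial>P)) \<le> 0"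
        using nonneg[OF P] by simp
      then show ?thesis using value_nonneg by (rule order_trans)
    qed
  qed

  show "two_point_value \<mu> d \<psi>u \<psi>l \<le> ratio_value \<mu> d \<psi>u \<psi>l"
    unfolding two_point_value_def
  proof (rule Sup_least, unfold mem_Collect_eq, elim exE conjE)
    fix y w1 w2 v1 v2
    assume y: "y = ereal ((w1 * \<psi>u v1 + w2 * \<psi>u v2) / (w1 * \<psi>l v1 + w2 * \<psi>l v2))"
      and w: "0 \<le> w1" "0 \<le> w2" "w1 + w2 = 1"
      and v: "v1 < \<mu> - d / 2" "\<mu> + d / 2 < v2"
      and mean: "w1 * v1 + w2 * v2 = \<mu>" and mad: "w1 * (\<mu> - v1) + w2 * (v2 - \<mu>) = d"
      and nz: "w1 * \<psi>l v1 + w2 * \<psi>l v2 \<noteq> 0"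
    have v\<mu>: "v1 \<le> \<mu>" "\<mu> \<le> v2" using v \<open>d > 0\<close> by auto
    obtain P where P: "P \<in> mad_distributions \<mu> d"
      "\<And>f :: real \<Rightarrow> real. f \<in> borel_measurable borel \<Longrightarrow> integrable P f"
      "\<And>f. f \<in> borel_measurable borel \<Longrightarrow> (\<integral>x. f x \<partial>P) = w1 * f v1 + w2 * f v2"
      using two_point_distribution[OF w v\<mu> mean mad] by blast
    show "y \<le> ratio_value \<mu> d \<psi>u \<psi>l"
      unfolding ratio_value_def y
      by (rule Sup_upper, rule CollectI, rule exI[of _ P])
        (simp add: P(1) P(2)[OF u_meas] P(2)[OF l_meas] P(3)[OF u_meas] P(3)[OF l_meas] nz)
  qed
qed

end
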